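(* Let $\mathcal P\subset\mathbb R^n$ be an $n$-dimensional convex polytope and consider $\dot x=Ax+a+Bu$, $x\in\mathcal P$, with $A\in\mathbb R^{n\times n}$, $a\in\mathbb R^n$, $B\in\mathbb R^{n\times m}$, under (A1) $\operatorname{rank}(B)=n-1$; (A2) $(A,B)$ controllable; (A3) $\operatorname{int}\mathcal P\cap\mathcal O=\emptyset$; (A4) $\mathcal F$ is an $(n-1)$-dimensional polytope in the boundary of $\mathcal P$. Suppose there exists a vertex $v_*$ of $\mathcal F$ with $v_*\in\mathcal F\cap\mathcal P^+$. Let $\tilde{\mathcal P}\subset\mathcal P$ be an $n$-dimensional polytope such that $\mathcal F$ is a facet of $\tilde{\mathcal P}$. Then $\mathcal P\xrightarrow{\mathcal P}\mathcal F$ implies $\tilde{\mathcal P}\xrightarrow{\tilde{\mathcal P}}\mathcal F$.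
   Context: $\mathcal B=\operatorname{Im}(B)$, $\mathcal O=\{x:Ax+a\in\mathcal B\}$; $\beta$ is the unit normal to $\mathcal B$ with $\beta^T(Ax+a)\le0$ for all $x\in\mathcal P$; $\mathcal P^+=\arg\max\{\beta^Tx:x\in\mathcal P\}$. For closed sets $\Omega,\Omega_f$, $\Omega\xrightarrow{\Omega}\Omega_f$ means: for every $x\in\Omega$ there exist a piecewise continuous control $u$ and $T\ge0$ such that the solution $\phi^u_t(x)$ satisfies $\phi^u_T(x)\in\Omega_f$ and $\phi^u_t(x)\in\Omega$ for all $t\in[0,T]$. *)

theory Defs
  imports "HOL-Analysis.Analysis"
begin

(* Kalman rank condition: rank [B, AB, ..., A^(n-1) B] = n, i.e. the columns of
   A^k B (k < n) span R^n. *)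
definition controllable :: "real^'n^'n \<Rightarrow> real^'m^'n \<Rightarrow> bool" where
  "controllable A B \<longleftrightarrow>
     span (\<Union>k\<in>{..<CARD('n)}. columns ((((**) A) ^^ k) B)) = UNIV"

(* piecewise continuous on [a,b]: finitely many discontinuity points, at which the
   one-sided limits exist *)
definition piecewise_continuous_on :: "real \<Rightarrow> real \<Rightarrow> (real \<Rightarrow> 'a::real_normed_vector) \<Rightarrow> bool" where
  "piecewise_continuous_on a b u \<longleftrightarrow>
     (\<exists>S. finite S \<and> continuous_on ({a..b} - S) u \<and>
          (\<forall>s\<in>S. (\<exists>l. (u \<longlongrightarrow> l) (at_left s)) \<and> (\<exists>l. (u \<longlongrightarrow> l) (at_right s))))"

(* x is the (Caratheodory) solution on [0,T] of  x' = A x + a + B u(t), x(0) = x0 *)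
definition is_solution ::
  "real^'n^'n \<Rightarrow> real^'n \<Rightarrow> real^'m^'n \<Rightarrow> (real \<Rightarrow> real^'m) \<Rightarrow> real^'n \<Rightarrow> real \<Rightarrow> (real \<Rightarrow> real^'n) \<Rightarrow> bool" where
  "is_solution A a B u x0 T x \<longleftrightarrow>
     continuous_on {0..T} x \<and>
     (\<forall>t\<in>{0..T}. x t = x0 + integral {0..t} (\<lambda>s. A *v x s + a + B *v u s))"

(* Omega --Omega--> Omega_f *)
definition reach ::
  "real^'n^'n \<Rightarrow> real^'n \<Rightarrow> real^'m^'n \<Rightarrow> (real^'n) set \<Rightarrow> (real^'n) set \<Rightarrow> bool" where
  "reach A a B \<Omega> \<Omega>f \<longleftrightarrow>
     (\<forall>x0\<in>\<Omega>. \<exists>u T x. T \<ge> 0 \<and> piecewise_continuous_on 0 T u \<and>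
        is_solution A a B u x0 T x \<and> x T \<in> \<Omega>f \<and> (\<forall>t\<in>{0..T}. x t \<in> \<Omega>))"

definition ImB :: "real^'m^'n \<Rightarrow> (real^'n) set" where
  "ImB B = range (\<lambda>u. B *v u)"

definition obs_set :: "real^'n^'n \<Rightarrow> real^'n \<Rightarrow> real^'m^'n \<Rightarrow> (real^'n) set" where
  "obs_set A a B = {x. A *v x + a \<in> ImB B}"

definition Pplus :: "real^'n \<Rightarrow> (real^'n) set \<Rightarrow> (real^'n) set" where
  "Pplus \<beta> P = {x \<in> P. \<forall>y\<in>P. \<beta> \<bullet> y \<le> \<beta> \<bullet> x}"

end

theory Submission
  imports Defs
begin

text \<open>Fix \<open>x0 \<in> Pt - F\<close>. As \<open>\<beta> \<perp> Im B\<close>, the component \<open>\<beta> \<bullet> x\<close> of every trajectory is driven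
  by the drift \<open>\<beta> \<bullet> (A x + a) \<le> 0\<close> alone. So the trajectory from \<open>x0\<close> into \<open>F\<close> inside \<open>P\<close>
  ends at some \<open>y \<in> F\<close> with \<open>\<beta> \<bullet> y \<le> \<beta> \<bullet> x0\<close>, with equality only if the drift vanishes at
  \<open>x0\<close> and \<open>y\<close>, while \<open>v \<in> F \<inter> P\<^sup>+\<close> satisfies \<open>\<beta> \<bullet> v \<ge> \<beta> \<bullet> x0\<close>.
  Inside the convex set \<open>Pt\<close> we steer along quadratic paths through the simplex spanned by \<open>x0\<close>
  and at most three points of \<open>F\<close>. Since the rank condition makes \<open>Im B\<close> the whole hyperplane
  \<open>\<beta>\<^sup>\<perp>\<close>, such a path is admissible once its \<open>\<beta>\<close>-component obeys the drift, which amounts to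
  three scalar equations on its coefficients; a continuity argument solves them with the path
  staying in the simplex. Controllability (\<open>\<beta>\<close> is no left eigenvector of \<open>A\<close>) together with
  \<open>dim F = n - 1\<close> provides points of \<open>F\<close> for which these equations are non-degenerate.\<close>

section \<open>The input matrix and the facet\<close>

lemma ImB_eq_orthogonal_hyperplane:
  fixes B :: "real^'m^'n" and \<beta> :: "real^'n"
  assumes rank: "rank B = CARD('n) - 1" and "\<beta> \<noteq> 0" and orth: "\<forall>y\<in>ImB B. \<beta> \<bullet> y = 0"
  shows "ImB B = {w. \<beta> \<bullet> w = 0}"
proof (rule subspace_dim_equal)
  show "subspace (ImB B)"
    unfolding ImB_def by (intro subspace_UNIV linear_subspace_image matrix_vector_mul_linear)
  show "subspace {w. \<beta> \<bullet> w = 0}" by (rule subspace_hyperplane)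
  show "ImB B \<subseteq> {w. \<beta> \<bullet> w = 0}" using orth by blast
  have "dim {w. \<beta> \<bullet> w = 0} = CARD('n) - 1" using dim_hyperplane[OF \<open>\<beta> \<noteq> 0\<close>] by simp
  then show "dim {w. \<beta> \<bullet> w = 0} \<le> dim (ImB B)"
    using rank by (simp add: rank_dim_range ImB_def)
qed

text \<open>The easy half of the Popov--Belevitch--Hautus test.\<close>
lemma controllable_imp_no_orthogonal_left_eigenvector:
  fixes A :: "real^'n^'n" and B :: "real^'m^'n" and \<beta> :: "real^'n"
  assumes ctrl: "controllable A B" and "\<beta> \<noteq> 0" and orth: "\<forall>y\<in>ImB B. \<beta> \<bullet> y = 0"
  shows "\<beta> v* A \<noteq> c *\<^sub>R \<beta>"
proof
  assume eig: "\<beta> v* A = c *\<^sub>R \<beta>"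
  have orth_power: "\<beta> \<bullet> ((((**) A) ^^ k) B *v x) = 0" for k x
  proof (induction k arbitrary: x)
    case 0
    then show ?case using orth by (simp add: ImB_def)
  next
    case (Suc k)
    have "\<beta> \<bullet> ((((**) A) ^^ Suc k) B *v x) = (\<beta> v* A) \<bullet> ((((**) A) ^^ k) B *v x)"
      by (simp add: matrix_vector_mul_assoc dot_lmul_matrix)
    also have "\<dots> = 0" using Suc by (simp add: eig)
    finally show ?case .
  qed
  have "span (\<Union>k\<in>{..<CARD('n)}. columns ((((**) A) ^^ k) B)) \<subseteq> {x. \<beta> \<bullet> x = 0}"
    using orth_power
    by (intro span_minimal subspace_hyperplane) (auto simp: columns_def matrix_vector_mult_basis[symmetric])
  then have "\<beta> \<bullet> \<beta> = 0" using ctrl unfolding controllable_def by blast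
  then show False using \<open>\<beta> \<noteq> 0\<close> by simp
qed

lemma face_of_codim1_not_in_hyperplane:
  fixes S F :: "'a::euclidean_space set"
  assumes "F face_of S" "convex S" "x \<in> S" "x \<notin> F" "aff_dim F = int DIM('a) - 1" "c \<noteq> 0"
  shows "\<exists>w\<in>F. c \<bullet> w \<noteq> c \<bullet> x"
proof (rule ccontr)
  assume "\<not> ?thesis"
  then have "affine hull F \<subseteq> {w. c \<bullet> w = c \<bullet> x}"
    by (intro hull_minimal affine_hyperplane) auto
  moreover have "F \<noteq> {}" using assms(5) by (cases "F = {}") auto
  ultimately have "affine hull F = {w. c \<bullet> w = c \<bullet> x}"
    using assms(5,6) by (intro affine_dim_equal) (auto simp: affine_hyperplane)
  then have "x \<in> affine hull F \<inter> S" using assms(3) by simp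
  then show False using face_of_imp_eq_affine_Int[OF assms(2,1)] assms(4) by simp
qed

section \<open>Admissible trajectories\<close>

definition steerable ::
  "real^'n^'n \<Rightarrow> real^'n \<Rightarrow> real^'m^'n \<Rightarrow> (real^'n) set \<Rightarrow> (real^'n) set \<Rightarrow> real^'n \<Rightarrow> bool" where
  "steerable A a B \<Omega> \<Omega>f x0 \<longleftrightarrow>
     (\<exists>u T x. T \<ge> 0 \<and> piecewise_continuous_on 0 T u \<and>
        is_solution A a B u x0 T x \<and> x T \<in> \<Omega>f \<and> (\<forall>t\<in>{0..T}. x t \<in> \<Omega>))"

lemma reach_iff_steerable: "reach A a B \<Omega> \<Omega>f \<longleftrightarrow> (\<forall>x0\<in>\<Omega>. steerable A a B \<Omega> \<Omega>f x0)"
  unfolding reach_def steerable_def ..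

lemma steerable_trivial:
  assumes "x0 \<in> \<Omega>f" "x0 \<in> \<Omega>"
  shows "steerable A a B \<Omega> \<Omega>f x0"
proof -
  have "is_solution A a B (\<lambda>_. 0) x0 0 (\<lambda>_. x0)" unfolding is_solution_def by simp
  moreover have "piecewise_continuous_on 0 0 (\<lambda>_. 0)"
    unfolding piecewise_continuous_on_def by (rule exI[of _ "{}"]) simp
  ultimately show ?thesis
    unfolding steerable_def using assms by (intro exI[of _ "\<lambda>_. 0"] exI[of _ 0] exI[of _ "\<lambda>_. x0"]) auto
qed

text \<open>The hypothesis \<open>x T \<noteq> x0\<close> excludes a non-integrable velocity, whose integral is the
  junk value \<open>0\<close>.\<close>
lemma solution_orthogonal_component:
  fixes A :: "real^'n^'n" and a :: "real^'n" and B :: "real^'m^'n" and \<beta> x0 :: "real^'n"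
  assumes orth: "\<forall>y\<in>ImB B. \<beta> \<bullet> y = 0" and sol: "is_solution A a B u x0 T x"
    and "T \<ge> 0" "x T \<noteq> x0"
  shows "\<beta> \<bullet> x T = \<beta> \<bullet> x0 + integral {0..T} (\<lambda>s. \<beta> \<bullet> (A *v x s + a))"
proof -
  define g where "g = (\<lambda>s. A *v x s + a + B *v u s)"
  have x_eq: "x T = x0 + integral {0..T} g"
    using sol \<open>T \<ge> 0\<close> unfolding is_solution_def g_def by auto
  then have "g integrable_on {0..T}" using \<open>x T \<noteq> x0\<close> not_integrable_integral by fastforce
  then have "\<beta> \<bullet> integral {0..T} g = integral {0..T} (\<lambda>s. \<beta> \<bullet> g s)"
    using integral_linear[OF _ bounded_linear_inner_right, of g _ \<beta>] by (simp add: o_def)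
  also have "(\<lambda>s. \<beta> \<bullet> g s) = (\<lambda>s. \<beta> \<bullet> (A *v x s + a))"
    using orth by (auto simp: g_def inner_add_right ImB_def)
  finally show ?thesis using x_eq by (simp add: inner_add_right)
qed

text \<open>Along an admissible trajectory \<open>(\<beta> \<bullet> x)' = \<beta> \<bullet> (A x + a) \<le> 0\<close>; if \<open>\<beta> \<bullet> x\<close> does not
  strictly decrease, this continuous derivative vanishes identically, in particular at both ends.\<close>
lemma steerable_imp_lower_target_point:
  fixes A :: "real^'n^'n" and a :: "real^'n" and B :: "real^'m^'n" and \<beta> x0 :: "real^'n"
  assumes orth: "\<forall>y\<in>ImB B. \<beta> \<bullet> y = 0" and drift: "\<forall>x\<in>\<Omega>. \<beta> \<bullet> (A *v x + a) \<le> 0"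
    and steer: "steerable A a B \<Omega> \<Omega>f x0" and "x0 \<notin> \<Omega>f"
  shows "\<exists>y\<in>\<Omega>f. \<beta> \<bullet> y \<le> \<beta> \<bullet> x0 \<and>
           (\<beta> \<bullet> y = \<beta> \<bullet> x0 \<longrightarrow> \<beta> \<bullet> (A *v x0 + a) = 0 \<and> \<beta> \<bullet> (A *v y + a) = 0)"
proof -
  obtain u T x where "T \<ge> 0" and sol: "is_solution A a B u x0 T x" and xT: "x T \<in> \<Omega>f"
    and in_\<Omega>: "\<forall>t\<in>{0..T}. x t \<in> \<Omega>"
    using steer unfolding steerable_def by blast
  define h where "h = (\<lambda>s. \<beta> \<bullet> (A *v x s + a))"
  have "x 0 = x0" using sol \<open>T \<ge> 0\<close> unfolding is_solution_def by auto
  then have "T > 0" using xT \<open>x0 \<notin> \<Omega>f\<close> \<open>T \<ge> 0\<close> by (cases "T = 0") auto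
  have xT_eq: "\<beta> \<bullet> x T = \<beta> \<bullet> x0 + integral {0..T} h"
    unfolding h_def using solution_orthogonal_component[OF orth sol \<open>T \<ge> 0\<close>] xT \<open>x0 \<notin> \<Omega>f\<close> by auto
  have cont_x: "continuous_on {0..T} x" using sol unfolding is_solution_def by blast
  have cont_h: "continuous_on {0..T} h" unfolding h_def
    by (intro continuous_intros linear_continuous_on_compose[OF cont_x] matrix_vector_mul_linear)
  have h_nonpos: "\<And>s. s \<in> {0..T} \<Longrightarrow> h s \<le> 0" using in_\<Omega> drift by (auto simp: h_def)
  have "integral {0..T} h \<le> 0"
    using integral_le[OF integrable_continuous_real[OF cont_h] integrable_0 h_nonpos] by simp
  moreover have "h 0 = 0 \<and> h T = 0" if "integral {0..T} h = 0"
  proof -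
    have "integral {0..T} (\<lambda>s. - h s) = 0" using that by (simp add: integral_neg)
    moreover have "continuous_on {0..T} (\<lambda>s. - h s)" using cont_h by (intro continuous_intros)
    then have "integral {0..T} (\<lambda>s. - h s) = 0 \<longleftrightarrow> (\<forall>s\<in>{0..T}. - h s = 0)"
      by (rule integral_eq_0_iff[OF _ \<open>T > 0\<close>]) (use h_nonpos in auto)
    ultimately have "\<forall>s\<in>{0..T}. h s = 0" by simp
    then show ?thesis using \<open>T > 0\<close> by auto
  qed
  ultimately show ?thesis
    using xT xT_eq \<open>x 0 = x0\<close> by (intro bexI[of _ "x T"]) (auto simp: h_def)
qed

section \<open>Quadratic paths through a simplex\<close>

text \<open>Since \<open>Im B\<close> contains the hyperplane \<open>\<beta>\<^sup>\<perp>\<close>, a quadratic path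
  \<open>x0 + t P + t\<^sup>2 Q\<close> is realised by a polynomial control as soon as its velocity matches the drift
  in the \<open>\<beta>\<close>-direction; comparing coefficients of \<open>1, t, t\<^sup>2\<close> gives the three hypotheses.\<close>
lemma steerable_quadratic_path:
  fixes A :: "real^'n^'n" and a :: "real^'n" and B :: "real^'m^'n" and \<beta> x0 P Q :: "real^'n"
  assumes ImB: "{w. \<beta> \<bullet> w = 0} \<subseteq> ImB B"
    and "T \<ge> 0"
    and drift0: "\<beta> \<bullet> P = \<beta> \<bullet> (A *v x0 + a)"
    and drift1: "2 * (\<beta> \<bullet> Q) = \<beta> \<bullet> (A *v P)"
    and drift2: "\<beta> \<bullet> (A *v Q) = 0"
    and path: "\<And>t. t \<in> {0..T} \<Longrightarrow> x0 + t *\<^sub>R P + t\<^sup>2 *\<^sub>R Q \<in> \<Omega>"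
    and final: "x0 + T *\<^sub>R P + T\<^sup>2 *\<^sub>R Q \<in> \<Omega>f"
  shows "steerable A a B \<Omega> \<Omega>f x0"
proof -
  have "P - A *v x0 - a \<in> ImB B" "2 *\<^sub>R Q - A *v P \<in> ImB B" "- (A *v Q) \<in> ImB B"
    using ImB drift0 drift1 drift2 by (auto simp: inner_diff_right inner_add_right)
  then obtain u0 u1 u2 where u0: "B *v u0 = P - A *v x0 - a" and u1: "B *v u1 = 2 *\<^sub>R Q - A *v P"
    and u2: "B *v u2 = - (A *v Q)"
    unfolding ImB_def by (metis rangeE)
  define u where "u = (\<lambda>t::real. u0 + t *\<^sub>R u1 + t\<^sup>2 *\<^sub>R u2)"
  define x where "x = (\<lambda>t::real. x0 + t *\<^sub>R P + t\<^sup>2 *\<^sub>R Q)"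
  have velocity: "A *v x s + a + B *v u s = P + (2 * s) *\<^sub>R Q" for s
    unfolding x_def u_def
    by (simp add: matrix_vector_right_distrib matrix_vector_mult_scaleR u0 u1 u2
        algebra_simps power2_eq_square)
  have "x t = x0 + integral {0..t} (\<lambda>s. A *v x s + a + B *v u s)" if "t \<ge> 0" for t
  proof -
    have "((\<lambda>s. P + (2 * s) *\<^sub>R Q) has_integral (t *\<^sub>R P + t\<^sup>2 *\<^sub>R Q) - (0 *\<^sub>R P + 0\<^sup>2 *\<^sub>R Q)) {0..t}"
      by (rule fundamental_theorem_of_calculus[OF that])
        (auto intro!: derivative_eq_intros simp: algebra_simps)
    then have "integral {0..t} (\<lambda>s. A *v x s + a + B *v u s) = t *\<^sub>R P + t\<^sup>2 *\<^sub>R Q"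
      by (simp add: velocity integral_unique)
    then show ?thesis by (simp add: x_def)
  qed
  then have "is_solution A a B u x0 T x"
    unfolding is_solution_def x_def by (auto intro!: continuous_intros)
  moreover have "piecewise_continuous_on 0 T u"
    unfolding piecewise_continuous_on_def u_def by (rule exI[of _ "{}"]) (auto intro!: continuous_intros)
  ultimately show ?thesis
    unfolding steerable_def using \<open>T \<ge> 0\<close> path final
    by (intro exI[of _ u] exI[of _ T] exI[of _ x]) (auto simp: x_def)
qed

lemma convex_sum_4:
  fixes S :: "'a::real_vector set"
  assumes "convex S" "p \<in> S" "q \<in> S" "r \<in> S" "s \<in> S"
    and "0 \<le> a" "0 \<le> b" "0 \<le> c" "0 \<le> d" "a + b + c + d = 1"
  shows "a *\<^sub>R p + b *\<^sub>R q + c *\<^sub>R r + d *\<^sub>R s \<in> S"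
proof -
  have "(\<Sum>j\<in>{0::nat,1,2,3}. ([a,b,c,d]!j) *\<^sub>R ([p,q,r,s]!j)) \<in> S"
    by (rule convex_sum) (use assms in \<open>auto simp: less_Suc_eq\<close>)
  then show ?thesis by (simp add: algebra_simps)
qed

text \<open>These conditions make \<open>\<tau> \<mapsto> (a1 \<tau> + b1 \<tau>\<^sup>2, a2 \<tau> + b2 \<tau>\<^sup>2, a3 \<tau>)\<close> run inside the
  standard 2-simplex for \<open>0 \<le> \<tau> \<le> 1\<close> and end on its face opposite the origin.\<close>
definition simplex_path_weights :: "real \<Rightarrow> real \<Rightarrow> real \<Rightarrow> real \<Rightarrow> real \<Rightarrow> bool" where
  "simplex_path_weights a1 a2 a3 b1 b2 \<longleftrightarrow>
     0 \<le> a1 \<and> 0 \<le> a2 \<and> 0 \<le> a3 \<and> 0 \<le> a1 + b1 \<and> 0 \<le> a2 + b2 \<and>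
     a1 + b1 + a2 + b2 + a3 = 1 \<and> a1 + a2 + a3 \<le> 2"

lemma simplex_path_weights_nonneg:
  assumes "simplex_path_weights a1 a2 a3 b1 b2" "0 \<le> \<tau>" "\<tau> \<le> 1"
  shows "0 \<le> a1 * \<tau> + b1 * \<tau>\<^sup>2" "0 \<le> a2 * \<tau> + b2 * \<tau>\<^sup>2" "0 \<le> a3 * \<tau>"
    and "0 \<le> 1 - (a1 * \<tau> + b1 * \<tau>\<^sup>2) - (a2 * \<tau> + b2 * \<tau>\<^sup>2) - a3 * \<tau>"
proof -
  note w = assms(1)[unfolded simplex_path_weights_def]
  have quadratic: "a1 * \<tau> + b1 * \<tau>\<^sup>2 = \<tau> * ((1 - \<tau>) * a1 + \<tau> * (a1 + b1))"
    "a2 * \<tau> + b2 * \<tau>\<^sup>2 = \<tau> * ((1 - \<tau>) * a2 + \<tau> * (a2 + b2))"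
    by (auto simp: algebra_simps power2_eq_square)
  have b1: "b1 = 1 - a1 - a2 - a3 - b2" using w by simp
  have remainder: "1 - (a1 * \<tau> + b1 * \<tau>\<^sup>2) - (a2 * \<tau> + b2 * \<tau>\<^sup>2) - a3 * \<tau>
      = (1 - \<tau>) * (1 + (1 - (a1 + a2 + a3)) * \<tau>)"
    unfolding b1 by (simp add: algebra_simps power2_eq_square)
  have "0 \<le> 1 + (1 - (a1 + a2 + a3)) * \<tau>"
    using mult_right_mono[of "a1 + a2 + a3 - 1" 1 \<tau>] w assms(2,3) by (simp add: algebra_simps)
  then show "0 \<le> 1 - (a1 * \<tau> + b1 * \<tau>\<^sup>2) - (a2 * \<tau> + b2 * \<tau>\<^sup>2) - a3 * \<tau>"
    unfolding remainder using assms(3) by simp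
  show "0 \<le> a1 * \<tau> + b1 * \<tau>\<^sup>2" "0 \<le> a2 * \<tau> + b2 * \<tau>\<^sup>2" "0 \<le> a3 * \<tau>"
    unfolding quadratic using w assms(2,3) by simp_all
qed

lemma steerable_via_simplex_path:
  fixes A :: "real^'n^'n" and a :: "real^'n" and B :: "real^'m^'n"
    and \<beta> x0 z1 z2 z3 :: "real^'n"
  assumes ImB: "{w. \<beta> \<bullet> w = 0} \<subseteq> ImB B"
    and S: "convex S" "x0 \<in> S" "F \<subseteq> S" and F: "convex F" "z1 \<in> F" "z2 \<in> F" "z3 \<in> F"
    and "T > 0" and weights: "simplex_path_weights a1 a2 a3 b1 b2"
    and eq0: "a1 * (\<beta> \<bullet> (z1 - x0)) + a2 * (\<beta> \<bullet> (z2 - x0)) + a3 * (\<beta> \<bullet> (z3 - x0))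
      = T * (\<beta> \<bullet> (A *v x0 + a))"
    and eq1: "2 * (b1 * (\<beta> \<bullet> (z1 - x0)) + b2 * (\<beta> \<bullet> (z2 - x0))) =
      T * (a1 * (\<beta> \<bullet> (A *v (z1 - x0))) + a2 * (\<beta> \<bullet> (A *v (z2 - x0))) + a3 * (\<beta> \<bullet> (A *v (z3 - x0))))"
    and eq2: "b1 * (\<beta> \<bullet> (A *v (z1 - x0))) + b2 * (\<beta> \<bullet> (A *v (z2 - x0))) = 0"
  shows "steerable A a B S F x0"
proof -
  define P where "P = (a1 / T) *\<^sub>R (z1 - x0) + (a2 / T) *\<^sub>R (z2 - x0) + (a3 / T) *\<^sub>R (z3 - x0)"
  define Q where "Q = (b1 / T\<^sup>2) *\<^sub>R (z1 - x0) + (b2 / T\<^sup>2) *\<^sub>R (z2 - x0)"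
  define w where "w = (\<lambda>\<tau>. (a1 * \<tau> + b1 * \<tau>\<^sup>2, a2 * \<tau> + b2 * \<tau>\<^sup>2, a3 * \<tau>))"
  have "T \<noteq> 0" using \<open>T > 0\<close> by simp
  have path_eq: "x0 + t *\<^sub>R P + t\<^sup>2 *\<^sub>R Q =
      (1 - fst (w (t/T)) - fst (snd (w (t/T))) - snd (snd (w (t/T)))) *\<^sub>R x0 +
      fst (w (t/T)) *\<^sub>R z1 + fst (snd (w (t/T))) *\<^sub>R z2 + snd (snd (w (t/T))) *\<^sub>R z3" for t
    using \<open>T \<noteq> 0\<close> by (simp add: P_def Q_def w_def vec_eq_iff field_simps power2_eq_square)
  show ?thesis
  proof (rule steerable_quadratic_path[OF ImB less_imp_le[OF \<open>T > 0\<close>]])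
    note linear_simps = inner_add_right inner_scaleR_right matrix_vector_right_distrib
      matrix_vector_mult_scaleR
    have "\<beta> \<bullet> P = (a1 * (\<beta> \<bullet> (z1 - x0)) + a2 * (\<beta> \<bullet> (z2 - x0)) + a3 * (\<beta> \<bullet> (z3 - x0))) / T"
      unfolding P_def by (simp only: linear_simps) (simp add: add_divide_distrib)
    then show "\<beta> \<bullet> P = \<beta> \<bullet> (A *v x0 + a)" using eq0 \<open>T \<noteq> 0\<close> by simp
    have "\<beta> \<bullet> (A *v P) = (a1 * (\<beta> \<bullet> (A *v (z1 - x0))) + a2 * (\<beta> \<bullet> (A *v (z2 - x0)))
        + a3 * (\<beta> \<bullet> (A *v (z3 - x0)))) / T"
      unfolding P_def by (simp only: linear_simps) (simp add: add_divide_distrib)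
    moreover have "2 * (\<beta> \<bullet> Q) = 2 * (b1 * (\<beta> \<bullet> (z1 - x0)) + b2 * (\<beta> \<bullet> (z2 - x0))) / T\<^sup>2"
      unfolding Q_def by (simp only: linear_simps) (simp add: add_divide_distrib)
    ultimately show "2 * (\<beta> \<bullet> Q) = \<beta> \<bullet> (A *v P)"
      using eq1 \<open>T \<noteq> 0\<close> by (simp add: power2_eq_square)
    have "\<beta> \<bullet> (A *v Q) = (b1 * (\<beta> \<bullet> (A *v (z1 - x0))) + b2 * (\<beta> \<bullet> (A *v (z2 - x0)))) / T\<^sup>2"
      unfolding Q_def by (simp only: linear_simps) (simp add: add_divide_distrib)
    then show "\<beta> \<bullet> (A *v Q) = 0" using eq2 by simp
    show "x0 + t *\<^sub>R P + t\<^sup>2 *\<^sub>R Q \<in> S" if "t \<in> {0..T}" for t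
      unfolding path_eq using simplex_path_weights_nonneg[OF weights, of "t/T"] that \<open>T > 0\<close> S F
      by (intro convex_sum_4) (auto simp: w_def)
    have "0 *\<^sub>R z1 + fst (w 1) *\<^sub>R z1 + fst (snd (w 1)) *\<^sub>R z2 + snd (snd (w 1)) *\<^sub>R z3 \<in> F"
      using simplex_path_weights_nonneg[OF weights, of 1] weights F
      by (intro convex_sum_4) (auto simp: w_def simplex_path_weights_def)
    moreover have "1 - (a1 + b1) - (a2 + b2) - a3 = 0"
      using weights by (simp add: simplex_path_weights_def)
    ultimately show "x0 + T *\<^sub>R P + T\<^sup>2 *\<^sub>R Q \<in> F"
      using \<open>T \<noteq> 0\<close> unfolding path_eq by (simp add: w_def)
  qed
qed

section \<open>Coefficients of the quadratic paths\<close>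

context
  fixes D1 D2 E1 E2 f0 :: real
begin

text \<open>Solutions of the three coefficient equations with prescribed end weights
  \<open>a1 + b1 = \<rho> (1 - \<theta>)\<close>, \<open>a2 + b2 = \<rho> \<theta>\<close>: the last equation forces \<open>(b1, b2) = k (E2, -E1)\<close>,
  and the other two then determine \<open>k\<close> and the time \<open>T\<close>.\<close>

definition interp_D :: "real \<Rightarrow> real" where
  "interp_D \<theta> = (1 - \<theta>) * D1 + \<theta> * D2"

definition interp_E :: "real \<Rightarrow> real" where
  "interp_E \<theta> = (1 - \<theta>) * E1 + \<theta> * E2"

definition flight_time :: "real \<Rightarrow> real \<Rightarrow> real" where
  "flight_time \<theta> \<rho> = 2 * \<rho> * interp_D \<theta> / (2 * f0 + \<rho> * interp_E \<theta>)"

definition lin_weight1 :: "real \<Rightarrow> real \<Rightarrow> real" where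
  "lin_weight1 \<theta> \<rho> = (flight_time \<theta> \<rho> * f0 * E2 - D2 * \<rho> * interp_E \<theta>) / (D1 * E2 - D2 * E1)"

definition lin_weight2 :: "real \<Rightarrow> real \<Rightarrow> real" where
  "lin_weight2 \<theta> \<rho> = (D1 * \<rho> * interp_E \<theta> - E1 * flight_time \<theta> \<rho> * f0) / (D1 * E2 - D2 * E1)"

definition quad_weight1 :: "real \<Rightarrow> real \<Rightarrow> real" where
  "quad_weight1 \<theta> \<rho> = flight_time \<theta> \<rho> * \<rho> * interp_E \<theta> * E2 / (2 * (D1 * E2 - D2 * E1))"

definition quad_weight2 :: "real \<Rightarrow> real \<Rightarrow> real" where
  "quad_weight2 \<theta> \<rho> = - flight_time \<theta> \<rho> * \<rho> * interp_E \<theta> * E1 / (2 * (D1 * E2 - D2 * E1))"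

lemma weight_identities:
  assumes \<Delta>: "D1 * E2 - D2 * E1 \<noteq> 0" and den: "2 * f0 + \<rho> * interp_E \<theta> \<noteq> 0"
  defines "T \<equiv> flight_time \<theta> \<rho>"
    and "a1 \<equiv> lin_weight1 \<theta> \<rho>" and "a2 \<equiv> lin_weight2 \<theta> \<rho>"
    and "b1 \<equiv> quad_weight1 \<theta> \<rho>" and "b2 \<equiv> quad_weight2 \<theta> \<rho>"
  shows "a1 + b1 = \<rho> * (1 - \<theta>)" "a2 + b2 = \<rho> * \<theta>" "a1 * D1 + a2 * D2 = T * f0"
    "2 * (b1 * D1 + b2 * D2) = T * (a1 * E1 + a2 * E2)" "b1 * E1 + b2 * E2 = 0"
proof -
  define Dt Et \<Delta> where "Dt = interp_D \<theta>" and "Et = interp_E \<theta>" and "\<Delta> = D1 * E2 - D2 * E1"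
  have T: "T * (2 * f0 + \<rho> * Et) = 2 * \<rho> * Dt"
    using den by (simp add: T_def flight_time_def Dt_def Et_def)
  have a1: "a1 = (T * f0 * E2 - D2 * \<rho> * Et) / \<Delta>" and a2: "a2 = (D1 * \<rho> * Et - E1 * T * f0) / \<Delta>"
    and b1: "b1 = T * \<rho> * Et * E2 / (2 * \<Delta>)" and b2: "b2 = - T * \<rho> * Et * E1 / (2 * \<Delta>)"
    by (simp_all add: a1_def a2_def b1_def b2_def lin_weight1_def lin_weight2_def quad_weight1_def
        quad_weight2_def T_def Et_def \<Delta>_def)
  have "\<Delta> \<noteq> 0" using \<Delta> by (simp add: \<Delta>_def)
  have "a1 + b1 = (T * (2 * f0 + \<rho> * Et) * E2 - 2 * D2 * \<rho> * Et) / (2 * \<Delta>)"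
    using \<open>\<Delta> \<noteq> 0\<close> by (simp add: a1 b1 field_simps)
  also have "\<dots> = \<rho> * (1 - \<theta>)"
    using \<open>\<Delta> \<noteq> 0\<close> unfolding T by (simp add: Dt_def Et_def \<Delta>_def interp_D_def interp_E_def field_simps)
  finally show "a1 + b1 = \<rho> * (1 - \<theta>)" .
  have "a2 + b2 = (2 * D1 * \<rho> * Et - T * (2 * f0 + \<rho> * Et) * E1) / (2 * \<Delta>)"
    using \<open>\<Delta> \<noteq> 0\<close> by (simp add: a2 b2 field_simps)
  also have "\<dots> = \<rho> * \<theta>"
    using \<open>\<Delta> \<noteq> 0\<close> unfolding T by (simp add: Dt_def Et_def \<Delta>_def interp_D_def interp_E_def field_simps)
  finally show "a2 + b2 = \<rho> * \<theta>" .
  have "(T * f0 * E2 - D2 * \<rho> * Et) * D1 + (D1 * \<rho> * Et - E1 * T * f0) * D2 = T * f0 * \<Delta>"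
    by (simp add: \<Delta>_def algebra_simps)
  then show "a1 * D1 + a2 * D2 = T * f0"
    using \<open>\<Delta> \<noteq> 0\<close> by (simp add: a1 a2 divide_simps)
  have "(T * f0 * E2 - D2 * \<rho> * Et) * E1 + (D1 * \<rho> * Et - E1 * T * f0) * E2 = \<rho> * Et * \<Delta>"
    by (simp add: \<Delta>_def algebra_simps)
  then have aE: "a1 * E1 + a2 * E2 = \<rho> * Et"
    using \<open>\<Delta> \<noteq> 0\<close> by (simp add: a1 a2 divide_simps)
  show "2 * (b1 * D1 + b2 * D2) = T * (a1 * E1 + a2 * E2)"
    using \<open>\<Delta> \<noteq> 0\<close> unfolding aE b1 b2 by (simp add: divide_simps) (simp add: \<Delta>_def algebra_simps)
  show "b1 * E1 + b2 * E2 = 0"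
    using \<open>\<Delta> \<noteq> 0\<close> by (simp add: b1 b2 field_simps)
qed

lemma path_coefficients_from_parameters:
  assumes \<Delta>: "D1 * E2 - D2 * E1 \<noteq> 0" and \<theta>: "0 \<le> \<theta>" "\<theta> \<le> 1" and \<rho>: "0 < \<rho>" "\<rho> \<le> 1"
    and "interp_D \<theta> < 0" and den: "2 * f0 + \<rho> * interp_E \<theta> < 0"
    and a: "0 \<le> lin_weight1 \<theta> \<rho>" "0 \<le> lin_weight2 \<theta> \<rho>"
      "lin_weight1 \<theta> \<rho> + lin_weight2 \<theta> \<rho> + (1 - \<rho>) \<le> 2"
  shows "\<exists>T a1 a2 b1 b2. T > 0 \<and> simplex_path_weights a1 a2 (1 - \<rho>) b1 b2 \<and>
    a1 * D1 + a2 * D2 = T * f0 \<and> 2 * (b1 * D1 + b2 * D2) = T * (a1 * E1 + a2 * E2) \<and>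
    b1 * E1 + b2 * E2 = 0"
proof (intro exI conjI)
  note ids = weight_identities[OF \<Delta> less_imp_neq[OF den]]
  have "2 * \<rho> * interp_D \<theta> < 0" using \<rho> \<open>interp_D \<theta> < 0\<close> by (simp add: mult_pos_neg)
  then show "flight_time \<theta> \<rho> > 0" unfolding flight_time_def using den by (rule divide_neg_neg)
  have "0 \<le> \<rho> * (1 - \<theta>)" "0 \<le> \<rho> * \<theta>" "\<rho> * (1 - \<theta>) + \<rho> * \<theta> = \<rho>"
    using \<theta> \<rho> by (simp_all add: algebra_simps)
  then show "simplex_path_weights (lin_weight1 \<theta> \<rho>) (lin_weight2 \<theta> \<rho>) (1 - \<rho>)
      (quad_weight1 \<theta> \<rho>) (quad_weight2 \<theta> \<rho>)"
    unfolding simplex_path_weights_def using ids(1,2) a \<rho> by linarith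
qed (use weight_identities[OF \<Delta> less_imp_neq[OF den]] in auto)

lemma interp_root_values:
  assumes \<Delta>: "D1 * E2 - D2 * E1 \<noteq> 0" and D: "D1 < 0" "0 \<le> D2"
    and f: "f0 \<le> 0" "f0 + E1 \<le> 0" "f0 + E2 \<le> 0"
  defines "\<theta>\<^sub>0 \<equiv> D1 / (D1 - D2)"
  shows "0 < \<theta>\<^sub>0" "\<theta>\<^sub>0 \<le> 1" "interp_D \<theta> = (\<theta> - \<theta>\<^sub>0) * (D2 - D1)" "2 * f0 + interp_E \<theta>\<^sub>0 < 0"
    "lin_weight1 \<theta>\<^sub>0 1 = D2 / (D2 - D1)" "lin_weight2 \<theta>\<^sub>0 1 = - D1 / (D2 - D1)"
proof -
  show \<theta>\<^sub>0: "0 < \<theta>\<^sub>0" "\<theta>\<^sub>0 \<le> 1" using D by (auto simp: \<theta>\<^sub>0_def field_simps)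
  show D_eq: "interp_D \<theta> = (\<theta> - \<theta>\<^sub>0) * (D2 - D1)" for \<theta>
    using D by (simp add: interp_D_def \<theta>\<^sub>0_def field_simps)
  define \<Delta> where "\<Delta> = D1 * E2 - D2 * E1"
  have "\<Delta> \<noteq> 0" "D2 - D1 > 0" using \<Delta> D by (simp_all add: \<Delta>_def)
  have "(1 - \<theta>\<^sub>0) * (D2 - D1) = D2" "\<theta>\<^sub>0 * (D2 - D1) = - D1"
    using D by (simp_all add: \<theta>\<^sub>0_def field_simps)
  then have "interp_E \<theta>\<^sub>0 * (D2 - D1) = - \<Delta>"
    unfolding interp_E_def \<Delta>_def by (simp add: algebra_simps)
  then have E_eq: "interp_E \<theta>\<^sub>0 = - \<Delta> / (D2 - D1)"
    using \<open>D2 - D1 > 0\<close> by (simp add: field_simps)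
  then have "interp_E \<theta>\<^sub>0 \<noteq> 0" using \<open>\<Delta> \<noteq> 0\<close> \<open>D2 - D1 > 0\<close> by simp
  have "f0 + interp_E \<theta>\<^sub>0 = (1 - \<theta>\<^sub>0) * (f0 + E1) + \<theta>\<^sub>0 * (f0 + E2)"
    by (simp add: interp_E_def algebra_simps)
  also have "\<dots> \<le> 0"
    using mult_nonneg_nonpos[of "1 - \<theta>\<^sub>0" "f0 + E1"] mult_nonneg_nonpos[of \<theta>\<^sub>0 "f0 + E2"] \<theta>\<^sub>0 f
    by linarith
  finally show "2 * f0 + interp_E \<theta>\<^sub>0 < 0"
    using \<open>interp_E \<theta>\<^sub>0 \<noteq> 0\<close> f(1) by (cases "f0 < 0") auto
  have "flight_time \<theta>\<^sub>0 1 = 0" by (simp add: flight_time_def D_eq)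
  then have "lin_weight1 \<theta>\<^sub>0 1 = - D2 * interp_E \<theta>\<^sub>0 / \<Delta>" "lin_weight2 \<theta>\<^sub>0 1 = D1 * interp_E \<theta>\<^sub>0 / \<Delta>"
    by (simp_all add: lin_weight1_def lin_weight2_def \<Delta>_def)
  then show "lin_weight1 \<theta>\<^sub>0 1 = D2 / (D2 - D1)" "lin_weight2 \<theta>\<^sub>0 1 = - D1 / (D2 - D1)"
    using \<open>\<Delta> \<noteq> 0\<close> by (simp_all add: E_eq)
qed

text \<open>With \<open>\<rho> = 1\<close>, let \<open>\<theta>\<close> increase to the root \<open>\<theta>\<^sub>0\<close> of \<open>interp_D\<close>: the time tends to \<open>0\<close>
  and the weights tend to the barycentric coordinates \<open>(D2, -D1) / (D2 - D1)\<close> of \<open>\<theta>\<^sub>0\<close>.\<close>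
lemma two_point_path_coefficients:
  assumes \<Delta>: "D1 * E2 - D2 * E1 \<noteq> 0" and D: "D1 < 0" "0 \<le> D2"
    and f: "f0 \<le> 0" "f0 + E1 \<le> 0" "f0 + E2 \<le> 0"
  shows "\<exists>T a1 a2 b1 b2. T > 0 \<and> simplex_path_weights a1 a2 0 b1 b2 \<and>
    a1 * D1 + a2 * D2 = T * f0 \<and> 2 * (b1 * D1 + b2 * D2) = T * (a1 * E1 + a2 * E2) \<and>
    b1 * E1 + b2 * E2 = 0"
proof -
  define \<theta>\<^sub>0 where "\<theta>\<^sub>0 = D1 / (D1 - D2)"
  note root = interp_root_values[OF assms, folded \<theta>\<^sub>0_def]
  have "isCont (\<lambda>\<theta>. 2 * f0 + interp_E \<theta>) \<theta>\<^sub>0" "isCont (\<lambda>\<theta>. lin_weight1 \<theta> 1) \<theta>\<^sub>0"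
    "isCont (\<lambda>\<theta>. lin_weight2 \<theta> 1) \<theta>\<^sub>0"
    using root(4) \<Delta> unfolding lin_weight1_def lin_weight2_def flight_time_def interp_D_def interp_E_def
    by (auto intro!: continuous_intros)
  then have lim: "((\<lambda>\<theta>. 2 * f0 + interp_E \<theta>) \<longlongrightarrow> 2 * f0 + interp_E \<theta>\<^sub>0) (at \<theta>\<^sub>0)"
    "((\<lambda>\<theta>. lin_weight1 \<theta> 1) \<longlongrightarrow> D2 / (D2 - D1)) (at \<theta>\<^sub>0)"
    "((\<lambda>\<theta>. lin_weight2 \<theta> 1) \<longlongrightarrow> - D1 / (D2 - D1)) (at \<theta>\<^sub>0)"
    unfolding isCont_def root(5,6) by simp_all
  have "D2 / (D2 - D1) + - D1 / (D2 - D1) < 2" "0 < - D1 / (D2 - D1)"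
    using D by (simp_all add: diff_divide_distrib[symmetric] divide_neg_pos)
  then have near: "\<forall>\<^sub>F \<theta> in at \<theta>\<^sub>0. 2 * f0 + interp_E \<theta> < 0 \<and> 0 < lin_weight2 \<theta> 1 \<and>
      lin_weight1 \<theta> 1 + lin_weight2 \<theta> 1 < 2 \<and> (0 < D2 \<longrightarrow> 0 < lin_weight1 \<theta> 1)"
    using order_tendstoD(2)[OF lim(1) root(4)] order_tendstoD(1)[OF lim(3)]
      order_tendstoD(2)[OF tendsto_add[OF lim(2,3)]] order_tendstoD(1)[OF lim(2), of 0] D
    by (cases "0 < D2") (auto elim: eventually_elim2 eventually_mono intro!: eventually_conj)
  have "\<forall>\<^sub>F \<theta> in at_left \<theta>\<^sub>0. \<theta> \<in> {0<..<\<theta>\<^sub>0} \<and> 2 * f0 + interp_E \<theta> < 0 \<and>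
      0 < lin_weight2 \<theta> 1 \<and> lin_weight1 \<theta> 1 + lin_weight2 \<theta> 1 < 2 \<and> (0 < D2 \<longrightarrow> 0 < lin_weight1 \<theta> 1)"
    using eventually_conj[OF eventually_at_left_real[OF root(1)]
        near[unfolded eventually_at_split, THEN conjunct1]] by simp
  then obtain \<theta> where \<theta>: "0 < \<theta>" "\<theta> < \<theta>\<^sub>0" and den: "2 * f0 + interp_E \<theta> < 0"
    and w: "0 < lin_weight2 \<theta> 1" "lin_weight1 \<theta> 1 + lin_weight2 \<theta> 1 < 2"
      "0 < D2 \<Longrightarrow> 0 < lin_weight1 \<theta> 1"
    using eventually_happens'[OF trivial_limit_at_left_real] by auto
  have "interp_D \<theta> < 0" using root(3)[of \<theta>] \<theta> D by (simp add: mult_neg_pos)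
  then have "flight_time \<theta> 1 > 0" using den by (simp add: flight_time_def divide_neg_neg)
  have "0 \<le> lin_weight1 \<theta> 1"
  proof (cases "0 < D2")
    case False
    then have "lin_weight1 \<theta> 1 = flight_time \<theta> 1 * f0 / D1"
      unfolding lin_weight1_def using D \<Delta> by simp
    then show ?thesis
      using \<open>flight_time \<theta> 1 > 0\<close> D f(1) by (simp add: divide_nonpos_neg mult_nonneg_nonpos)
  qed (use w in auto)
  then show ?thesis
    using path_coefficients_from_parameters[of \<theta> 1] \<Delta> \<theta> root(2) \<open>interp_D \<theta> < 0\<close> den w by simp
qed

lemma interp_D_negative_point:
  assumes "D1 < 0"
  obtains \<theta> where "0 < \<theta>" "\<theta> < 1" "interp_D \<theta> < 0"
proof
  define \<theta> where "\<theta> = - D1 / (2 * (\<bar>D2\<bar> - D1))"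
  have "\<bar>D2\<bar> - D1 > 0" using \<open>D1 < 0\<close> by simp
  show \<theta>: "0 < \<theta>" "\<theta> < 1" using \<open>D1 < 0\<close> \<open>\<bar>D2\<bar> - D1 > 0\<close> by (auto simp: \<theta>_def field_simps)
  have "interp_D \<theta> = D1 + \<theta> * (D2 - D1)" by (simp add: interp_D_def algebra_simps)
  also have "\<dots> \<le> D1 + \<theta> * (\<bar>D2\<bar> - D1)" using \<theta> by (intro add_left_mono mult_left_mono) auto
  also have "\<theta> * (\<bar>D2\<bar> - D1) = - D1 / 2" using \<open>\<bar>D2\<bar> - D1 > 0\<close> by (simp add: \<theta>_def field_simps)
  finally show "interp_D \<theta> < 0" using \<open>D1 < 0\<close> by simp
qed

text \<open>For fixed \<open>\<theta>\<close> with \<open>interp_D \<theta> < 0\<close> let \<open>\<rho> \<rightarrow> 0\<^sup>+\<close>: the linear weights are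
  \<open>\<rho> (1 - \<theta>) + o(\<rho>)\<close> and \<open>\<rho> \<theta> + o(\<rho>)\<close>, and the third point absorbs the remaining weight.\<close>
lemma three_point_path_coefficients:
  assumes \<Delta>: "D1 * E2 - D2 * E1 \<noteq> 0" and "D1 < 0" "f0 < 0"
  shows "\<exists>T a1 a2 a3 b1 b2. T > 0 \<and> simplex_path_weights a1 a2 a3 b1 b2 \<and>
    a1 * D1 + a2 * D2 = T * f0 \<and> 2 * (b1 * D1 + b2 * D2) = T * (a1 * E1 + a2 * E2) \<and>
    b1 * E1 + b2 * E2 = 0"
proof -
  obtain \<theta> where \<theta>: "0 < \<theta>" "\<theta> < 1" and "interp_D \<theta> < 0"
    using interp_D_negative_point[OF \<open>D1 < 0\<close>] .
  define \<Delta> where "\<Delta> = D1 * E2 - D2 * E1"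
  define G1 where "G1 \<rho> = (2 * interp_D \<theta> * f0 * E2 / (2 * f0 + \<rho> * interp_E \<theta>) - D2 * interp_E \<theta>) / \<Delta>" for \<rho>
  define G2 where "G2 \<rho> = (D1 * interp_E \<theta> - E1 * (2 * interp_D \<theta> * f0 / (2 * f0 + \<rho> * interp_E \<theta>))) / \<Delta>" for \<rho>
  have weights: "lin_weight1 \<theta> \<rho> = \<rho> * G1 \<rho>" "lin_weight2 \<theta> \<rho> = \<rho> * G2 \<rho>" for \<rho>
    by (simp_all add: lin_weight1_def lin_weight2_def flight_time_def G1_def G2_def \<Delta>_def algebra_simps)
  have "G1 0 = 1 - \<theta>" "G2 0 = \<theta>"
    using \<open>f0 < 0\<close> \<Delta> by (simp_all add: G1_def G2_def \<Delta>_def interp_D_def interp_E_def field_simps)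
  moreover have "isCont G1 0" "isCont G2 0" "isCont (\<lambda>\<rho>. 2 * f0 + \<rho> * interp_E \<theta>) 0"
    using \<open>f0 < 0\<close> \<Delta> unfolding G1_def G2_def \<Delta>_def by (auto intro!: continuous_intros)
  ultimately have lim: "(G1 \<longlongrightarrow> 1 - \<theta>) (at 0)" "(G2 \<longlongrightarrow> \<theta>) (at 0)"
    "((\<lambda>\<rho>. 2 * f0 + \<rho> * interp_E \<theta>) \<longlongrightarrow> 2 * f0) (at 0)"
    unfolding isCont_def by simp_all
  have near: "\<forall>\<^sub>F \<rho> in at 0. 2 * f0 + \<rho> * interp_E \<theta> < 0 \<and> 0 < G1 \<rho> \<and> 0 < G2 \<rho> \<and> G1 \<rho> + G2 \<rho> < 2"
    using order_tendstoD(2)[OF lim(3)] order_tendstoD(1)[OF lim(1)] order_tendstoD(1)[OF lim(2)]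
      order_tendstoD(2)[OF tendsto_add[OF lim(1,2)]] \<theta> \<open>f0 < 0\<close>
    by (intro eventually_conj) auto
  then have "\<forall>\<^sub>F \<rho> in at_right 0. \<rho> \<in> {0<..<1} \<and> 2 * f0 + \<rho> * interp_E \<theta> < 0 \<and>
      0 < G1 \<rho> \<and> 0 < G2 \<rho> \<and> G1 \<rho> + G2 \<rho> < 2"
    using eventually_conj[OF eventually_at_right_real[of 0 1]
        near[unfolded eventually_at_split, THEN conjunct2]] by simp
  then obtain \<rho> where \<rho>: "0 < \<rho>" "\<rho> < 1" and den: "2 * f0 + \<rho> * interp_E \<theta> < 0"
    and G: "0 < G1 \<rho>" "0 < G2 \<rho>" "G1 \<rho> + G2 \<rho> < 2"
    using eventually_happens'[OF trivial_limit_at_right_real] by auto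
  have "\<rho> * (G1 \<rho> + G2 \<rho>) \<le> \<rho> * 2" using \<rho> G by (intro mult_left_mono) auto
  then have "\<exists>T a1 a2 b1 b2. T > 0 \<and> simplex_path_weights a1 a2 (1 - \<rho>) b1 b2 \<and>
      a1 * D1 + a2 * D2 = T * f0 \<and> 2 * (b1 * D1 + b2 * D2) = T * (a1 * E1 + a2 * E2) \<and>
      b1 * E1 + b2 * E2 = 0"
    using \<Delta> \<theta> \<rho> \<open>interp_D \<theta> < 0\<close> den G
    by (intro path_coefficients_from_parameters) (auto simp: weights algebra_simps)
  then show ?thesis by blast
qed

end

section \<open>Steering into a facet\<close>

lemma sign_pair_or_degenerate:
  fixes D E :: "'a \<Rightarrow> real"
  assumes "y \<in> F" "v \<in> F" "w \<in> F" "D y < 0" "0 \<le> D v" and yw: "D y * E w - D w * E y \<noteq> 0"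
  shows "(\<exists>p\<in>F. \<exists>q\<in>F. D p < 0 \<and> 0 \<le> D q \<and> D p * E q - D q * E p \<noteq> 0) \<or> (D v = 0 \<and> E v = 0)"
proof (cases "\<exists>p\<in>F. \<exists>q\<in>F. D p < 0 \<and> 0 \<le> D q \<and> D p * E q - D q * E p \<noteq> 0")
  case none: False
  then have yv: "D y * E v = D v * E y" using \<open>y \<in> F\<close> \<open>v \<in> F\<close> \<open>D y < 0\<close> \<open>0 \<le> D v\<close> by auto
  have "D w < 0"
  proof (rule ccontr)
    assume "\<not> D w < 0"
    then show False using none \<open>y \<in> F\<close> \<open>w \<in> F\<close> \<open>D y < 0\<close> yw by force
  qed
  then have wv: "D w * E v = D v * E w" using none \<open>w \<in> F\<close> \<open>v \<in> F\<close> \<open>0 \<le> D v\<close> by auto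
  have "E v * (D y * E w - D w * E y) = E w * (D y * E v) - E y * (D w * E v)"
    by (simp add: algebra_simps)
  also have "\<dots> = 0" unfolding yv wv by (simp add: algebra_simps)
  finally have "E v = 0" using yw by simp
  have "D v * (D y * E w - D w * E y) = D y * (D v * E w) - D w * (D v * E y)"
    by (simp add: algebra_simps)
  also have "\<dots> = 0" unfolding yv[symmetric] wv[symmetric] by (simp add: algebra_simps)
  finally have "D v = 0" using yw by (metis mult_eq_0_iff)
  with \<open>E v = 0\<close> show ?thesis by blast
qed blast

lemma inner_affine_split:
  fixes A :: "real^'n^'n" and a :: "real^'n"
  shows "\<beta> \<bullet> (A *v z + a) = \<beta> \<bullet> (A *v x + a) + \<beta> \<bullet> (A *v (z - x))"
  by (simp add: matrix_vector_mult_diff_distrib inner_diff_right inner_add_right)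

context
  fixes A :: "real^'n^'n" and a :: "real^'n" and B :: "real^'m^'n" and \<beta> x0 :: "real^'n"
    and S F :: "(real^'n) set"
  assumes ImB: "{w. \<beta> \<bullet> w = 0} \<subseteq> ImB B" and S: "convex S" "x0 \<in> S" and F: "F face_of S"
begin

private lemmas simplex_path = steerable_via_simplex_path[where A = A and a = a,
    OF ImB S face_of_imp_subset[OF F] face_of_imp_convex[OF F]]

lemma steerable_straight:
  assumes "z \<in> F" "\<beta> \<bullet> z = \<beta> \<bullet> x0" "\<beta> \<bullet> (A *v x0 + a) = 0" "\<beta> \<bullet> (A *v z + a) = 0"
  shows "steerable A a B S F x0"
  using simplex_path[of z z z 1 0 0 1 0 0] assms inner_affine_split[of \<beta> A z a x0]
  by (simp add: simplex_path_weights_def inner_diff_right)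

lemma steerable_two_points:
  assumes "p \<in> F" "q \<in> F" "\<beta> \<bullet> (p - x0) < 0" "0 \<le> \<beta> \<bullet> (q - x0)"
    and "\<beta> \<bullet> (A *v x0 + a) \<le> 0" "\<beta> \<bullet> (A *v p + a) \<le> 0" "\<beta> \<bullet> (A *v q + a) \<le> 0"
    and "\<beta> \<bullet> (p - x0) * (\<beta> \<bullet> (A *v (q - x0))) - \<beta> \<bullet> (q - x0) * (\<beta> \<bullet> (A *v (p - x0))) \<noteq> 0"
  shows "steerable A a B S F x0"
proof -
  obtain T a1 a2 b1 b2 where "T > 0" "simplex_path_weights a1 a2 0 b1 b2"
    "a1 * (\<beta> \<bullet> (p - x0)) + a2 * (\<beta> \<bullet> (q - x0)) = T * (\<beta> \<bullet> (A *v x0 + a))"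
    "2 * (b1 * (\<beta> \<bullet> (p - x0)) + b2 * (\<beta> \<bullet> (q - x0))) =
      T * (a1 * (\<beta> \<bullet> (A *v (p - x0))) + a2 * (\<beta> \<bullet> (A *v (q - x0))))"
    "b1 * (\<beta> \<bullet> (A *v (p - x0))) + b2 * (\<beta> \<bullet> (A *v (q - x0))) = 0"
    using two_point_path_coefficients assms
      inner_affine_split[of \<beta> A p a x0] inner_affine_split[of \<beta> A q a x0]
    by metis
  then show ?thesis using simplex_path[of p q p T a1 a2 0 b1 b2] assms by simp
qed

lemma steerable_three_points:
  assumes "p \<in> F" "q \<in> F" "z \<in> F" "\<beta> \<bullet> (p - x0) < 0" "\<beta> \<bullet> (A *v x0 + a) < 0"
    and "\<beta> \<bullet> (p - x0) * (\<beta> \<bullet> (A *v (q - x0))) - \<beta> \<bullet> (q - x0) * (\<beta> \<bullet> (A *v (p - x0))) \<noteq> 0"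
    and "\<beta> \<bullet> (z - x0) = 0" "\<beta> \<bullet> (A *v (z - x0)) = 0"
  shows "steerable A a B S F x0"
proof -
  obtain T a1 a2 a3 b1 b2 where "T > 0" "simplex_path_weights a1 a2 a3 b1 b2"
    "a1 * (\<beta> \<bullet> (p - x0)) + a2 * (\<beta> \<bullet> (q - x0)) = T * (\<beta> \<bullet> (A *v x0 + a))"
    "2 * (b1 * (\<beta> \<bullet> (p - x0)) + b2 * (\<beta> \<bullet> (q - x0))) =
      T * (a1 * (\<beta> \<bullet> (A *v (p - x0))) + a2 * (\<beta> \<bullet> (A *v (q - x0))))"
    "b1 * (\<beta> \<bullet> (A *v (p - x0))) + b2 * (\<beta> \<bullet> (A *v (q - x0))) = 0"
    using three_point_path_coefficients assms by metis
  then show ?thesis using simplex_path[of p q z T a1 a2 a3 b1 b2] assms by simp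
qed

text \<open>Two points of \<open>F\<close> on either side of the \<open>\<beta>\<close>-level of \<open>x0\<close> are reachable together
  unless their vectors \<open>(\<beta> \<bullet> (z - x0), \<beta> \<bullet> A (z - x0))\<close> are parallel. Controllability and
  \<open>dim F = n - 1\<close> provide a point of \<open>F\<close> breaking this degeneracy; in the fully degenerate
  case \<open>v\<close> itself is a drift-free point on the level of \<open>x0\<close>.\<close>
lemma steerable_to_codim1_face:
  assumes no_eig: "\<And>c. \<beta> v* A \<noteq> c *\<^sub>R \<beta>"
    and F_dim: "aff_dim F = int CARD('n) - 1" and "x0 \<notin> F"
    and drift: "\<forall>z\<in>insert x0 F. \<beta> \<bullet> (A *v z + a) \<le> 0"
    and y: "y \<in> F" "\<beta> \<bullet> y \<le> \<beta> \<bullet> x0"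
      "\<beta> \<bullet> y = \<beta> \<bullet> x0 \<longrightarrow> \<beta> \<bullet> (A *v x0 + a) = 0 \<and> \<beta> \<bullet> (A *v y + a) = 0"
    and v: "v \<in> F" "\<beta> \<bullet> x0 \<le> \<beta> \<bullet> v"
  shows "steerable A a B S F x0"
proof (cases "\<beta> \<bullet> y = \<beta> \<bullet> x0")
  case True
  then show ?thesis using steerable_straight y by blast
next
  case False
  define D where "D z = \<beta> \<bullet> (z - x0)" for z
  define E where "E z = \<beta> \<bullet> (A *v (z - x0))" for z
  have "D y < 0" using y(2) False by (simp add: D_def inner_diff_right)
  define c where "c = D y *\<^sub>R (\<beta> v* A) - E y *\<^sub>R \<beta>"
  have "c \<noteq> 0"
  proof
    assume "c = 0"
    then have eq: "D y *\<^sub>R (\<beta> v* A) = E y *\<^sub>R \<beta>" by (simp add: c_def)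
    have "\<beta> v* A = (1 / D y) *\<^sub>R (D y *\<^sub>R (\<beta> v* A))" using \<open>D y < 0\<close> by simp
    also have "\<dots> = (E y / D y) *\<^sub>R \<beta>" unfolding eq by simp
    finally show False using no_eig by blast
  qed
  then obtain w where "w \<in> F" and "c \<bullet> w \<noteq> c \<bullet> x0"
    using face_of_codim1_not_in_hyperplane[OF F S \<open>x0 \<notin> F\<close>] F_dim by auto
  then have yw: "D y * E w - D w * E y \<noteq> 0"
    by (simp add: c_def D_def E_def inner_diff_left inner_diff_right dot_lmul_matrix algebra_simps)
  have "0 \<le> D v" using v(2) by (simp add: D_def inner_diff_right)
  from sign_pair_or_degenerate[where D = D and E = E, OF y(1) v(1) \<open>w \<in> F\<close> \<open>D y < 0\<close> this yw]
  show ?thesis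
  proof (elim disjE bexE conjE)
    fix p q assume "p \<in> F" "q \<in> F" "D p < 0" "0 \<le> D q" "D p * E q - D q * E p \<noteq> 0"
    then show ?thesis using steerable_two_points drift unfolding D_def E_def by simp
  next
    assume "D v = 0" "E v = 0"
    then show ?thesis
      using steerable_straight[OF v(1)] steerable_three_points[OF y(1) \<open>w \<in> F\<close> v(1)] drift
        \<open>D y < 0\<close> yw inner_affine_split[of \<beta> A v a x0]
      unfolding D_def E_def by (fastforce simp: inner_diff_right)
  qed
qed

end

theorem proposition2:
  fixes A :: "real^'n^'n" and a :: "real^'n" and B :: "real^'m^'n"
    and P F Pt :: "(real^'n) set" and \<beta> v :: "real^'n"
  assumes P: "polytope P" "aff_dim P = int CARD('n)"
    and A1: "rank B = CARD('n) - 1"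
    and A2: "controllable A B"
    and A3: "interior P \<inter> obs_set A a B = {}"
    and A4: "polytope F" "aff_dim F = int CARD('n) - 1" "F \<subseteq> frontier P"
    and beta: "norm \<beta> = 1" "\<forall>y\<in>ImB B. \<beta> \<bullet> y = 0" "\<forall>x\<in>P. \<beta> \<bullet> (A *v x + a) \<le> 0"
    and v: "v extreme_point_of F" "v \<in> F \<inter> Pplus \<beta> P"
    and Pt: "polytope Pt" "Pt \<subseteq> P" "aff_dim Pt = int CARD('n)" "F facet_of Pt"
    and reachP: "reach A a B P F"
  shows "reach A a B Pt F"
  unfolding reach_iff_steerable
proof
  fix x0 assume "x0 \<in> Pt"
  have "\<beta> \<noteq> 0" using beta(1) by auto
  have F_face: "F face_of Pt" using Pt(4) by (rule facet_of_imp_face_of)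
  show "steerable A a B Pt F x0"
  proof (cases "x0 \<in> F")
    case True
    then show ?thesis using \<open>x0 \<in> Pt\<close> by (rule steerable_trivial)
  next
    case False
    have "x0 \<in> P" "F \<subseteq> P" using \<open>x0 \<in> Pt\<close> face_of_imp_subset[OF F_face] Pt(2) by auto
    obtain y where "y \<in> F" "\<beta> \<bullet> y \<le> \<beta> \<bullet> x0"
      "\<beta> \<bullet> y = \<beta> \<bullet> x0 \<longrightarrow> \<beta> \<bullet> (A *v x0 + a) = 0 \<and> \<beta> \<bullet> (A *v y + a) = 0"
      using steerable_imp_lower_target_point[OF beta(2,3)] reachP \<open>x0 \<in> P\<close> False
      unfolding reach_iff_steerable by blast
    moreover have "v \<in> F" "\<beta> \<bullet> x0 \<le> \<beta> \<bullet> v" using v(2) \<open>x0 \<in> P\<close> by (auto simp: Pplus_def)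
    ultimately show ?thesis
      using ImB_eq_orthogonal_hyperplane[OF A1 \<open>\<beta> \<noteq> 0\<close> beta(2)]
        controllable_imp_no_orthogonal_left_eigenvector[OF A2 \<open>\<beta> \<noteq> 0\<close> beta(2)]
        beta(3) \<open>x0 \<in> P\<close> \<open>F \<subseteq> P\<close> polytope_imp_convex[OF Pt(1)] \<open>x0 \<in> Pt\<close> F_face A4(2) False
      by (intro steerable_to_codim1_face[of \<beta> B Pt x0 F A a]) auto
  qed
qed

end
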